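(* Let $(X_1,\dots,X_N)$ be an exchangeable occupancy model on $A_{N,r}$ and fix $1\le n<N$. Let $S_n=X_1+\dots+X_n$ and let $1\le s\le r$ be such that $P\{S_n=s\}>0$. Then, conditionally on the event $\{S_n=s\}$, the variables $X_1,\dots,X_n$ are distributed according to an exchangeable occupancy model on $A_{n,s}$.
   Context: For integers $n,r\ge1$, $A_{n,r}$ is the set of vectors $(x_1,\dots,x_n)$ of non-negative integers with $\sum_{j=1}^n x_j=r$. An occupancy model on $A_{n,r}$ is a probability distribution on $A_{n,r}$ (equivalently, the law of a random vector $(X_1,\dots,X_n)$ with values in $A_{n,r}$, whose components are called occupancy numbers; by abuse of language the random vector itself is also called an occupancy model). It is an exchangeable occupancy model (EOM) if $(X_1,\dots,X_n)$ is exchangeable, i.e. its law is invariant under all permutations of the coordinates. *)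

theory Defs
  imports "HOL-Probability.Probability"
begin

definition occ_vectors :: "nat \<Rightarrow> nat \<Rightarrow> (nat \<Rightarrow> nat) set" where
  "occ_vectors n r = {x \<in> {1..n} \<rightarrow>\<^sub>E UNIV. (\<Sum>j=1..n. x j) = r}"

abbreviation vec_algebra :: "nat \<Rightarrow> (nat \<Rightarrow> nat) measure" where
  "vec_algebra n \<equiv> (\<Pi>\<^sub>M j\<in>{1..n}. count_space UNIV)"

text \<open>
  A distribution on \<open>occ_vectors n r\<close> is represented as a probability measure on all vectors
  of \<open>n\<close> natural numbers which gives mass 1 to \<open>occ_vectors n r\<close>. The set of all such vectors
  is countable, so the product sigma-algebra is its full power set.
\<close>

definition occupancy_model :: "nat \<Rightarrow> nat \<Rightarrow> (nat \<Rightarrow> nat) measure \<Rightarrow> bool" where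
  "occupancy_model n r \<mu> \<longleftrightarrow>
     prob_space \<mu> \<and> sets \<mu> = sets (vec_algebra n) \<and> measure \<mu> (occ_vectors n r) = 1"

definition exchangeable :: "nat \<Rightarrow> (nat \<Rightarrow> nat) measure \<Rightarrow> bool" where
  "exchangeable n \<mu> \<longleftrightarrow>
     (\<forall>\<pi>. \<pi> permutes {1..n} \<longrightarrow>
        distr \<mu> (vec_algebra n) (\<lambda>x. \<lambda>j\<in>{1..n}. x (\<pi> j)) = \<mu>)"

definition EOM :: "nat \<Rightarrow> nat \<Rightarrow> (nat \<Rightarrow> nat) measure \<Rightarrow> bool" where
  "EOM n r \<mu> \<longleftrightarrow> occupancy_model n r \<mu> \<and> exchangeable n \<mu>"

definition joint_law :: "'a measure \<Rightarrow> nat \<Rightarrow> (nat \<Rightarrow> 'a \<Rightarrow> nat) \<Rightarrow> (nat \<Rightarrow> nat) measure" where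
  "joint_law M n X = distr M (vec_algebra n) (\<lambda>\<omega>. \<lambda>j\<in>{1..n}. X j \<omega>)"

end

theory Submission
  imports Defs
begin

text \<open>A permutation \<open>\<pi>\<close> of \<open>{1..n}\<close> extends to one of
  \<open>{1..N}\<close> fixing the remaining indices, so exchangeability says that permuting the
  first \<open>n\<close> variables leaves the law of all \<open>N\<close> unchanged. It also leaves
  \<open>S_n\<close> unchanged, hence the event \<open>S_n = s\<close>. The conditional law of the
  first \<open>n\<close> variables given \<open>S_n = s\<close> is determined by the joint law of
  all \<open>N\<close> (\<open>joint_law_conditional_cong\<close>), so it is the same for the
  permuted and the original family, and this is exchangeability by
  \<open>exchangeable_joint_law_iff\<close>. That the conditional law lives on vectors with sum
  \<open>s\<close> is immediate from the conditioning
  (\<open>occupancy_model_conditional\<close>).\<close>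

lemma measurable_joint:
  assumes "\<And>j. j \<in> {1..n} \<Longrightarrow> X j \<in> measurable M (count_space UNIV)"
  shows "(\<lambda>\<omega>. \<lambda>j\<in>{1..n}. X j \<omega>) \<in> measurable M (vec_algebra n)"
  using assms by (intro measurable_restrict) auto

lemma measurable_sum_count_space:
  fixes X :: "'i \<Rightarrow> 'a \<Rightarrow> nat"
  assumes "\<And>j. j \<in> I \<Longrightarrow> X j \<in> measurable M (count_space UNIV)"
  shows "(\<lambda>\<omega>. \<Sum>j\<in>I. X j \<omega>) \<in> measurable M (count_space UNIV)"
proof -
  \<comment> \<open>On \<open>nat\<close> the Borel sets are all sets, so closure of Borel functions
    under finite sums carries over to the discrete sigma-algebra.\<close>
  have *: "measurable M (count_space UNIV) = measurable M (borel :: nat measure)"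
    by (intro measurable_cong_sets) (auto simp: sets_borel_eq_count_space)
  show ?thesis
    using assms unfolding * by (intro borel_measurable_sum) auto
qed

lemma measurable_sum_vec:
  assumes "n \<le> N"
  shows "(\<lambda>x. \<Sum>j=1..n. x j) \<in> measurable (vec_algebra N) (count_space UNIV)"
  using assms by (intro measurable_sum_count_space measurable_component_singleton) auto

text \<open>Pushing the law forward along a coordinate permutation amounts to composing that
  permutation with the random vector, which reindexes the family. This moves exchangeability from
  measures on vectors to the random variables themselves, where conditioning is easier to
  handle.\<close>

lemma exchangeable_joint_law_iff:
  assumes X: "\<And>j. j \<in> {1..n} \<Longrightarrow> X j \<in> measurable M (count_space UNIV)"
  shows "exchangeable n (joint_law M n X) \<longleftrightarrow>
    (\<forall>\<pi>. \<pi> permutes {1..n} \<longrightarrow> joint_law M n (\<lambda>j. X (\<pi> j)) = joint_law M n X)"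
proof -
  have "distr (joint_law M n X) (vec_algebra n) (\<lambda>x. \<lambda>j\<in>{1..n}. x (\<pi> j))
      = joint_law M n (\<lambda>j. X (\<pi> j))" if \<pi>: "\<pi> permutes {1..n}" for \<pi>
  proof -
    have "(\<lambda>x. \<lambda>j\<in>{1..n}. x (\<pi> j)) \<in> measurable (vec_algebra n) (vec_algebra n)"
      using permutes_in_image[OF \<pi>]
      by (intro measurable_restrict measurable_component_singleton) auto
    then have "distr (joint_law M n X) (vec_algebra n) (\<lambda>x. \<lambda>j\<in>{1..n}. x (\<pi> j))
        = distr M (vec_algebra n)
            ((\<lambda>x. \<lambda>j\<in>{1..n}. x (\<pi> j)) \<circ> (\<lambda>\<omega>. \<lambda>j\<in>{1..n}. X j \<omega>))"
      unfolding joint_law_def by (rule distr_distr[OF _ measurable_joint[OF X]])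
    also have "\<dots> = joint_law M n (\<lambda>j. X (\<pi> j))"
      unfolding joint_law_def
      using permutes_in_image[OF \<pi>] by (intro distr_cong) (auto simp: fun_eq_iff)
    finally show ?thesis .
  qed
  then show ?thesis
    by (auto simp: exchangeable_def)
qed

text \<open>A conditional probability given the partial sum is a quotient of two masses under the
  law of the full vector, so it cannot distinguish families with equal law. The events for
  \<open>X\<close> and \<open>Y\<close> may differ as subsets of \<open>space M\<close>; only their
  images in the space of vectors matter.\<close>

lemma joint_law_conditional_cong:
  assumes "n \<le> N"
    and X: "\<And>j. j \<in> {1..N} \<Longrightarrow> X j \<in> measurable M (count_space UNIV)"
    and Y: "\<And>j. j \<in> {1..N} \<Longrightarrow> Y j \<in> measurable M (count_space UNIV)"
    and eq: "joint_law M N X = joint_law M N Y"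
  shows "joint_law (uniform_measure M {\<omega> \<in> space M. (\<Sum>j=1..n. X j \<omega>) = s}) n X
    = joint_law (uniform_measure M {\<omega> \<in> space M. (\<Sum>j=1..n. Y j \<omega>) = s}) n Y"
proof -
  \<comment> \<open>\<open>C B\<close> is the event "partial sum is \<open>s\<close> and the first
    \<open>n\<close> coordinates lie in \<open>B\<close>", expressed in the space of
    \<open>N\<close>-vectors and so independently of the family. Taking \<open>B\<close> to be the
    whole space leaves the conditioning event alone.\<close>
  define C where "C B =
    {x \<in> space (vec_algebra N). (\<Sum>j=1..n. x j) = s \<and> restrict x {1..n} \<in> B}" for B
  define E where "E Z = {\<omega> \<in> space M. (\<Sum>j=1..n. Z j \<omega>) = s}" for Z :: "nat \<Rightarrow> 'a \<Rightarrow> nat"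
  have C: "C B \<in> sets (vec_algebra N)" if "B \<in> sets (vec_algebra n)" for B
  proof -
    have "(\<lambda>x. restrict x {1..n}) \<in> measurable (vec_algebra N) (vec_algebra n)"
      using \<open>n \<le> N\<close> by (intro measurable_restrict_subset) auto
    then have "((\<lambda>x. \<Sum>j=1..n. x j) -` {s} \<inter> space (vec_algebra N)) \<inter>
        ((\<lambda>x. restrict x {1..n}) -` B \<inter> space (vec_algebra N)) \<in> sets (vec_algebra N)"
      by (intro sets.Int measurable_sets[OF measurable_sum_vec[OF \<open>n \<le> N\<close>]]
          measurable_sets[OF _ that]) auto
    also have "((\<lambda>x. \<Sum>j=1..n. x j) -` {s} \<inter> space (vec_algebra N)) \<inter>
        ((\<lambda>x. restrict x {1..n}) -` B \<inter> space (vec_algebra N)) = C B"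
      by (auto simp: C_def)
    finally show ?thesis .
  qed
  \<comment> \<open>The right-hand side mentions \<open>Z\<close> only through
    \<open>joint_law M N Z\<close>; this is the quotient that settles the lemma.\<close>
  have cond: "emeasure (joint_law (uniform_measure M (E Z)) n Z) B
      = emeasure (joint_law M N Z) (C B) / emeasure (joint_law M N Z) (C (space (vec_algebra n)))"
    if Z: "\<And>j. j \<in> {1..N} \<Longrightarrow> Z j \<in> measurable M (count_space UNIV)"
      and B: "B \<in> sets (vec_algebra n)" for Z B
  proof -
    have Zn: "Z j \<in> measurable M (count_space UNIV)" if "j \<in> {1..n}" for j
      using that \<open>n \<le> N\<close> by (intro Z) auto
    have "(\<lambda>\<omega>. \<Sum>j=1..n. Z j \<omega>) -` {s} \<inter> space M \<in> sets M"
      by (intro measurable_sets[OF measurable_sum_count_space] Zn) auto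
    also have "(\<lambda>\<omega>. \<Sum>j=1..n. Z j \<omega>) -` {s} \<inter> space M = E Z"
      by (auto simp: E_def)
    finally have E: "E Z \<in> sets M" .
    \<comment> \<open>Used twice: with \<open>B\<close> for the numerator and with the whole space
      for the denominator.\<close>
    have joint: "emeasure M (E Z \<inter> ((\<lambda>\<omega>. \<lambda>j\<in>{1..n}. Z j \<omega>) -` B' \<inter> space M))
      = emeasure (joint_law M N Z) (C B')" if B': "B' \<in> sets (vec_algebra n)" for B'
    proof -
      have restr: "restrict (\<lambda>j\<in>{1..N}. Z j \<omega>) {1..n} = (\<lambda>j\<in>{1..n}. Z j \<omega>)" for \<omega>
        using \<open>n \<le> N\<close> by (auto simp: fun_eq_iff)
      have sum: "(\<Sum>j=1..n. (\<lambda>j\<in>{1..N}. Z j \<omega>) j) = (\<Sum>j=1..n. Z j \<omega>)" for \<omega>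
        using \<open>n \<le> N\<close> by (intro sum.cong) auto
      have "(\<lambda>\<omega>. \<lambda>j\<in>{1..N}. Z j \<omega>) -` C B' \<inter> space M
          = E Z \<inter> ((\<lambda>\<omega>. \<lambda>j\<in>{1..n}. Z j \<omega>) -` B' \<inter> space M)"
        unfolding C_def E_def vimage_def mem_Collect_eq restr sum
        by (auto simp: space_PiM)
      then show ?thesis
        unfolding joint_law_def
        by (subst emeasure_distr[OF measurable_joint[OF Z] C[OF B']]) auto
    qed
    have Zm: "(\<lambda>\<omega>. \<lambda>j\<in>{1..n}. Z j \<omega>) \<in> measurable M (vec_algebra n)"
      by (intro measurable_joint Zn)
    then have Zm': "(\<lambda>\<omega>. \<lambda>j\<in>{1..n}. Z j \<omega>) \<in> measurable (uniform_measure M (E Z)) (vec_algebra n)"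
      by (simp cong: measurable_cong_sets)
    have "E Z = E Z \<inter> ((\<lambda>\<omega>. \<lambda>j\<in>{1..n}. Z j \<omega>) -` space (vec_algebra n) \<inter> space M)"
      by (auto simp: E_def space_PiM)
    with joint[OF sets.top]
    have "emeasure M (E Z) = emeasure (joint_law M N Z) (C (space (vec_algebra n)))"
      by simp
    with joint[OF B]
    show "emeasure (joint_law (uniform_measure M (E Z)) n Z) B
      = emeasure (joint_law M N Z) (C B) / emeasure (joint_law M N Z) (C (space (vec_algebra n)))"
      unfolding joint_law_def[of _ n]
      using E measurable_sets[OF Zm B] by (subst emeasure_distr[OF Zm' B]) simp
  qed
  have "joint_law (uniform_measure M (E X)) n X = joint_law (uniform_measure M (E Y)) n Y"
  proof (rule measure_eqI)
    fix B assume "B \<in> sets (joint_law (uniform_measure M (E X)) n X)"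
    then have B: "B \<in> sets (vec_algebra n)"
      by (simp add: joint_law_def)
    show "emeasure (joint_law (uniform_measure M (E X)) n X) B
        = emeasure (joint_law (uniform_measure M (E Y)) n Y) B"
      using cond[OF X B] cond[OF Y B] by (simp add: eq)
  qed (simp add: joint_law_def)
  then show ?thesis
    by (simp add: E_def)
qed

text \<open>The vector of the first \<open>n\<close> variables lies in
  \<open>occ_vectors n s\<close> exactly on the conditioning event, which has conditional
  probability 1. Exchangeability does not enter.\<close>

lemma occupancy_model_conditional:
  assumes "prob_space M"
    and X: "\<And>j. j \<in> {1..n} \<Longrightarrow> X j \<in> measurable M (count_space UNIV)"
    and pos: "measure M {\<omega> \<in> space M. (\<Sum>j=1..n. X j \<omega>) = s} > 0"
  shows "occupancy_model n s
    (joint_law (uniform_measure M {\<omega> \<in> space M. (\<Sum>j=1..n. X j \<omega>) = s}) n X)"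
proof -
  interpret prob_space M by fact
  define E where "E = {\<omega> \<in> space M. (\<Sum>j=1..n. X j \<omega>) = s}"
  define Y where "Y \<omega> = (\<lambda>j\<in>{1..n}. X j \<omega>)" for \<omega>
  have E0: "emeasure M E \<noteq> 0"
    using pos by (auto simp: E_def measure_def)
  \<comment> \<open>A non-measurable set has \<open>emeasure\<close> 0 by convention, so nonzero
    mass already forces measurability.\<close>
  have E: "E \<in> sets M"
    using E0 emeasure_notin_sets by blast
  interpret U: prob_space "uniform_measure M E"
    using E0 by (intro prob_space_uniform_measure) auto
  have Y: "Y \<in> measurable (uniform_measure M E) (vec_algebra n)"
    using measurable_joint[OF X] unfolding Y_def by (simp cong: measurable_cong_sets)
  have occ: "occ_vectors n s \<in> sets (vec_algebra n)"
  proof -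
    have "(\<lambda>x. \<Sum>j=1..n. x j) -` {s} \<inter> space (vec_algebra n) \<in> sets (vec_algebra n)"
      by (intro measurable_sets[OF measurable_sum_vec]) auto
    also have "(\<lambda>x. \<Sum>j=1..n. x j) -` {s} \<inter> space (vec_algebra n) = occ_vectors n s"
      by (auto simp: occ_vectors_def space_PiM)
    finally show ?thesis .
  qed
  have vim: "Y -` occ_vectors n s \<inter> space M = E"
    by (auto simp: Y_def E_def occ_vectors_def)
  have "measure (distr (uniform_measure M E) (vec_algebra n) Y) (occ_vectors n s)
      = measure (uniform_measure M E) E"
    using measure_distr[OF Y occ] vim by simp
  also have "\<dots> = 1"
    using E E0 by (simp add: measure_def ennreal_divide_self less_top[symmetric])
  finally show ?thesis
    using U.prob_space_distr[OF Y]
    unfolding occupancy_model_def joint_law_def E_def[symmetric] Y_def by simp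
qed

theorem proposition6p2:
  fixes M :: "'a measure" and X :: "nat \<Rightarrow> 'a \<Rightarrow> nat" and N n r s :: nat
  assumes "prob_space M"
    and "\<And>j. j \<in> {1..N} \<Longrightarrow> X j \<in> measurable M (count_space UNIV)"
    and "EOM N r (joint_law M N X)"
    and "1 \<le> n" and "n < N"
    and "1 \<le> s" and "s \<le> r"
    and "measure M {\<omega> \<in> space M. (\<Sum>j=1..n. X j \<omega>) = s} > 0"
  shows "EOM n s
           (joint_law (uniform_measure M {\<omega> \<in> space M. (\<Sum>j=1..n. X j \<omega>) = s}) n X)"
proof -
  let ?U = "uniform_measure M {\<omega> \<in> space M. (\<Sum>j=1..n. X j \<omega>) = s}"
  note X = assms(2)
  have Xn: "X j \<in> measurable M (count_space UNIV)" if "j \<in> {1..n}" for j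
    using that \<open>n < N\<close> by (intro X) auto
  have XU: "X j \<in> measurable ?U (count_space UNIV)" if "j \<in> {1..n}" for j
    using Xn[OF that] by (simp cong: measurable_cong_sets)
  have exch: "joint_law M N (\<lambda>j. X (\<pi> j)) = joint_law M N X" if "\<pi> permutes {1..N}" for \<pi>
    using assms(3) that exchangeable_joint_law_iff[OF X] by (simp add: EOM_def)
  have "joint_law ?U n (\<lambda>j. X (\<pi> j)) = joint_law ?U n X" if \<pi>: "\<pi> permutes {1..n}" for \<pi>
  proof -
    \<comment> \<open>\<open>permutes\<close> includes fixing every point outside the set, so
      \<open>\<pi>\<close> itself serves as its extension to \<open>{1..N}\<close>.\<close>
    have \<pi>N: "\<pi> permutes {1..N}"
      using \<pi> \<open>n < N\<close> by (auto elim: permutes_subset)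
    have "(\<Sum>j=1..n. X (\<pi> j) \<omega>) = (\<Sum>j=1..n. X j \<omega>)" for \<omega>
      using sum.permute[OF \<pi>, of "\<lambda>j. X j \<omega>"] by (simp add: o_def)
    \<comment> \<open>The left side conditions on the partial sum of the permuted family, as the
      congruence lemma requires; by the invariance of the sum just shown, this is the same event as
      in \<open>?U\<close>.\<close>
    moreover have "joint_law (uniform_measure M {\<omega> \<in> space M. (\<Sum>j=1..n. X (\<pi> j) \<omega>) = s}) n
        (\<lambda>j. X (\<pi> j)) = joint_law ?U n X"
      using \<open>n < N\<close> permutes_in_image[OF \<pi>N]
      by (intro joint_law_conditional_cong[OF _ _ _ exch[OF \<pi>N]] X) auto
    ultimately show ?thesis
      by simp
  qed
  then have "exchangeable n (joint_law ?U n X)"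
    using exchangeable_joint_law_iff[OF XU] by simp
  with occupancy_model_conditional[OF assms(1) Xn assms(8)] show ?thesis
    by (simp add: EOM_def)
qed

end
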